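(* (No-UHP Theorem.) For any single-photon waveguide QED system with finitely many two-level emitters point-coupled to finitely many waveguides, the scattering parameters, regarded as meromorphic functions of the complex energy $E$ (equivalently, of the momentum $k=E$ or of the detuning $\Delta_k=E-\Omega$ for real $\Omega$), have no poles in the open upper half-plane $\{\operatorname{Im}E>0\}$.
   Context: Units are $\hbar=v_g=1$. A waveguide QED system consists of waveguides $w\in\{1,\dots,W\}$, each a copy of $\mathbb R$ carrying a right-moving and a left-moving photon field with linear dispersion (extended to all energies, so that $k=E$), and emitters (qubits) $Q\in\{1,\dots,N\}$ with excitation energies $\Omega_Q>0$. Emitter $Q$ couples to waveguide $w$ at the point $x_{Q,w}\in\mathbb R$ with real strength $V_{Q,w}\ge 0$ ($V_{Q,w}=0$ means no coupling). There is no non-radiative loss. In the single-excitation sector the Hamiltonian (point coupling, rotating-wave approximation) acts on right/left-moving field amplitudes $\phi_{R,w},\phi_{L,w}$ and qubit amplitudes $e_Q$, and the stationary Schrödinger equation at energy $E$ is $$E\phi_{R,w}=-i\phi_{R,w}'+\sum_Q V_{Q,w}e_Q\,\delta(x-x_{Q,w}),\qquad E\phi_{L,w}=i\phi_{L,w}'+\sum_Q V_{Q,w}e_Q\,\delta(x-x_{Q,w}),$$ $$(E-\Omega_Q)e_Q=\sum_w V_{Q,w}\big(\phi_{R,w}(x_{Q,w})+\phi_{L,w}(x_{Q,w})\big).$$ At a jump, the field value is the average of its one-sided limits (i.e. $\Theta(0)=1/2$ for the Heaviside function $\Theta$). The scattering eigenstate for a right-moving plane wave incident in waveguide $w_0$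 is the solution of the form (with $k=E$) $$\phi_{R,w}(x)=\delta_{w,w_0}e^{ikx}-i\sum_Q V_{Q,w}e_Q\,e^{ik(x-x_{Q,w})}\Theta(x-x_{Q,w}),$$ $$\phi_{L,w}(x)=-i\sum_Q V_{Q,w}e_Q\,e^{-ik(x-x_{Q,w})}\Theta(x_{Q,w}-x),$$ where the $e_Q=e_Q(E)$ are determined by the $N$ linear equations obtained by substituting these fields into the third equation. The eigenstate for a left-moving incident plane wave $e^{-ikx}$ is defined in the same way, with the incident term placed in $\phi_{L,w_0}$. The determinant of the linear system is an entire function of $E$ that is not identically zero, so the $e_Q(E)$ are meromorphic functions on $\mathbb C$. The scattering parameters are: the emitter excitation coefficients $e_Q(E)$, and, for every waveguide, the coefficients multiplying $e^{ikx}$ in $\phi_{R,w}$ and $e^{-ikx}$ in $\phi_{L,w}$ on each of the open intervals into which the coupling points divide the waveguide (in particular the transmission and reflection coefficients in the outermost intervals), for all incident channels. For a single emitter at $x=0$ in one waveguide with $V=\sqrt{J_0}$ they are $t_k=\Delta_k/(\Delta_k+iJ_0)$, $r_k=-iJ_0/(\Delta_k+iJ_0)$, $e_k=\sqrt{J_0}/(\Delta_k+iJ_0)$. *)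

theory Defs
  imports "HOL-Complex_Analysis.Complex_Analysis"
begin

record ('q, 'w) waveguide_system =
  frequency :: "'q \<Rightarrow> real"
  position :: "'q \<Rightarrow> 'w \<Rightarrow> real"
  coupling :: "'q \<Rightarrow> 'w \<Rightarrow> real"

definition heaviside :: "real \<Rightarrow> real" where
  "heaviside x = (if x < 0 then 0 else if x = 0 then 1/2 else 1)"

datatype direction = Rightward | Leftward

text \<open>
  Scattering ansatz at energy \<open>E\<close> for a plane wave incident in direction \<open>d\<close> in waveguide \<open>w0\<close>, with
  qubit amplitudes \<open>e\<close>.  For arbitrary \<open>e\<close> these fields satisfy the two field equations
  \<open>E \<phi>\<^sub>R = -\<i> \<phi>\<^sub>R' + (\<Sum>Q. V Q w e Q \<delta>(x - x Q w))\<close> and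
  \<open>E \<phi>\<^sub>L = \<i> \<phi>\<^sub>L' + (\<Sum>Q. V Q w e Q \<delta>(x - x Q w))\<close> of the stationary
  Schroedinger equation; since \<open>heaviside 0 = 1/2\<close>, the value at a jump is the mean of the one-sided
  limits.
\<close>

definition right_field ::
  "('q::finite, 'w) waveguide_system \<Rightarrow> direction \<Rightarrow> 'w \<Rightarrow> complex \<Rightarrow> ('q \<Rightarrow> complex)
     \<Rightarrow> 'w \<Rightarrow> real \<Rightarrow> complex" where
  "right_field S d w0 E e w x =
     (if d = Rightward \<and> w = w0 then exp (\<i> * E * of_real x) else 0)
     - \<i> * (\<Sum>Q\<in>UNIV. of_real (coupling S Q w) * e Q
              * exp (\<i> * E * of_real (x - position S Q w))
              * of_real (heaviside (x - position S Q w)))"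

definition left_field ::
  "('q::finite, 'w) waveguide_system \<Rightarrow> direction \<Rightarrow> 'w \<Rightarrow> complex \<Rightarrow> ('q \<Rightarrow> complex)
     \<Rightarrow> 'w \<Rightarrow> real \<Rightarrow> complex" where
  "left_field S d w0 E e w x =
     (if d = Leftward \<and> w = w0 then exp (- \<i> * E * of_real x) else 0)
     - \<i> * (\<Sum>Q\<in>UNIV. of_real (coupling S Q w) * e Q
              * exp (- \<i> * E * of_real (x - position S Q w))
              * of_real (heaviside (position S Q w - x)))"

definition emitter_equations ::
  "('q::finite, 'w::finite) waveguide_system \<Rightarrow> direction \<Rightarrow> 'w \<Rightarrow> complex \<Rightarrow> ('q \<Rightarrow> complex) \<Rightarrow> bool"
where
  "emitter_equations S d w0 E e \<longleftrightarrow>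
     (\<forall>Q. (E - of_real (frequency S Q)) * e Q =
        (\<Sum>w\<in>UNIV. of_real (coupling S Q w) *
           (right_field S d w0 E e w (position S Q w) + left_field S d w0 E e w (position S Q w))))"

text \<open>
  Where the determinant of the linear system vanishes there is no unique solution and the value below
  is unspecified.  This is harmless: neither \<^const>\<open>meromorphic_on\<close> nor \<^const>\<open>is_pole\<close> depends
  on the values of a function at isolated points.
\<close>

definition emitter_amplitudes ::
  "('q::finite, 'w::finite) waveguide_system \<Rightarrow> direction \<Rightarrow> 'w \<Rightarrow> complex \<Rightarrow> 'q \<Rightarrow> complex" where
  "emitter_amplitudes S d w0 E = (THE e. emitter_equations S d w0 E e)"

definition coupling_points :: "('q, 'w) waveguide_system \<Rightarrow> 'w \<Rightarrow> real set" where
  "coupling_points S w = {position S Q w | Q. coupling S Q w \<noteq> 0}"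

definition right_coefficient ::
  "('q::finite, 'w::finite) waveguide_system \<Rightarrow> direction \<Rightarrow> 'w \<Rightarrow> 'w \<Rightarrow> real set \<Rightarrow> complex \<Rightarrow> complex"
where
  "right_coefficient S d w0 w I E =
     (THE c. \<forall>x\<in>I. right_field S d w0 E (emitter_amplitudes S d w0 E) w x = c * exp (\<i> * E * of_real x))"

definition left_coefficient ::
  "('q::finite, 'w::finite) waveguide_system \<Rightarrow> direction \<Rightarrow> 'w \<Rightarrow> 'w \<Rightarrow> real set \<Rightarrow> complex \<Rightarrow> complex"
where
  "left_coefficient S d w0 w I E =
     (THE c. \<forall>x\<in>I. left_field S d w0 E (emitter_amplitudes S d w0 E) w x = c * exp (- \<i> * E * of_real x))"

text \<open>
  The connected components of the complement of the coupling points are the open intervals into which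
  these points divide the waveguide; the two unbounded ones give the transmission and reflection
  coefficients.
\<close>

inductive_set scattering_parameters ::
  "('q::finite, 'w::finite) waveguide_system \<Rightarrow> (complex \<Rightarrow> complex) set"
  for S :: "('q, 'w) waveguide_system" where
  emitter: "(\<lambda>E. emitter_amplitudes S d w0 E Q) \<in> scattering_parameters S"
| right: "I \<in> components (- coupling_points S w) \<Longrightarrow>
    right_coefficient S d w0 w I \<in> scattering_parameters S"
| left: "I \<in> components (- coupling_points S w) \<Longrightarrow>
    left_coefficient S d w0 w I \<in> scattering_parameters S"

end

theory Submission imports Defs begin

text \<open>
  Eliminating the fields turns the emitter equations into a linear system \<open>A(E) e = b(E)\<close> with
  entire coefficients and \<open>A(E) = E - \<Omega> + \<i> \<Sum>\<^sub>w (V\<^sub>Q\<^sub>w V\<^sub>P\<^sub>w exp (\<i> E \<bar>x\<^sub>Q\<^sub>w - x\<^sub>P\<^sub>w\<bar>))\<close>.  For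
  \<open>E = a + \<i> b\<close> with \<open>b > 0\<close> the real part \<open>exp (-b \<bar>x - y\<bar>) cos (a (x - y))\<close> of the exponential is a
  positive semidefinite kernel, so \<open>Im \<langle>e, A(E) e\<rangle> \<ge> b \<bar>e\<bar>\<^sup>2\<close> and \<open>A(E)\<close> is invertible.  By Cramer's rule
  the amplitudes are then meromorphic, and holomorphic in the upper half-plane.  Every other
  scattering parameter is an affine combination of amplitudes with entire coefficients.
\<close>

section \<open>Positive semidefinite kernels\<close>

text \<open>Induction on the number of points. Subtracting the minimum \<open>m\<close> from every
  \<open>s i\<close> splits off the term \<open>m\<close> times a square, and makes the row and
  column of a minimiser \<open>k\<close> vanish, so the rest is the same kernel over
  \<open>A - {k}\<close> with values that are still nonnegative.\<close>

lemma min_kernel_nonneg: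
  fixes s c :: "'a \<Rightarrow> real"
  assumes "finite A" "\<And>i. i \<in> A \<Longrightarrow> 0 \<le> s i"
  shows "0 \<le> (\<Sum>i\<in>A. \<Sum>j\<in>A. c i * c j * min (s i) (s j))"
  using assms
proof (induction "card A" arbitrary: A s)
  case 0
  then show ?case by simp
next
  case (Suc n)
  define m where "m = Min (s ` A)"
  have ne: "A \<noteq> {}" using Suc.hyps(2) by auto
  have m_le: "m \<le> s i" if "i \<in> A" for i
    using that Suc.prems(1) by (simp add: m_def)
  have "m \<in> s ` A"
    unfolding m_def using ne Suc.prems(1) by (intro Min_in) auto
  then obtain k where k: "k \<in> A" "s k = m" by auto
  have m_nonneg: "0 \<le> m" using Suc.prems(2)[OF k(1)] k(2) by simp
  let ?t = "\<lambda>i. s i - m"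
  have drop: "(\<Sum>i\<in>A. g i) = (\<Sum>i\<in>A - {k}. g i)" if "g k = 0" for g :: "'a \<Rightarrow> real"
    using that Suc.prems(1) k(1) by (simp add: sum.remove)
  have zero: "min (?t k) (?t j) = 0" "min (?t j) (?t k) = 0" if "j \<in> A" for j
    using m_le[OF that] k(2) by auto
  have "(\<Sum>i\<in>A. \<Sum>j\<in>A. c i * c j * min (s i) (s j))
      = (\<Sum>i\<in>A. \<Sum>j\<in>A. c i * c j * min (?t i) (?t j) + m * (c i * c j))"
    by (intro sum.cong refl) (auto simp: min_def algebra_simps)
  also have "\<dots> = (\<Sum>i\<in>A. \<Sum>j\<in>A. c i * c j * min (?t i) (?t j)) + m * (\<Sum>i\<in>A. c i)\<^sup>2"
    unfolding power2_eq_square sum_product by (simp add: sum.distrib sum_distrib_left)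
  also have "(\<Sum>i\<in>A. \<Sum>j\<in>A. c i * c j * min (?t i) (?t j))
      = (\<Sum>i\<in>A - {k}. \<Sum>j\<in>A. c i * c j * min (?t i) (?t j))"
    using zero by (intro drop sum.neutral) auto
  also have "\<dots> = (\<Sum>i\<in>A - {k}. \<Sum>j\<in>A - {k}. c i * c j * min (?t i) (?t j))"
    using zero by (intro sum.cong refl drop) auto
  finally have eq: "(\<Sum>i\<in>A. \<Sum>j\<in>A. c i * c j * min (s i) (s j))
      = (\<Sum>i\<in>A - {k}. \<Sum>j\<in>A - {k}. c i * c j * min (?t i) (?t j)) + m * (\<Sum>i\<in>A. c i)\<^sup>2" .
  have "0 \<le> (\<Sum>i\<in>A - {k}. \<Sum>j\<in>A - {k}. c i * c j * min (?t i) (?t j))"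
    using Suc.hyps(2) Suc.prems(1) k(1) m_le by (intro Suc.hyps(1)) auto
  then show ?case
    unfolding eq using m_nonneg by simp
qed

text \<open>The kernel is a rescaled minimum: \<open>exp (- b * y) * exp (- b * z) * min (exp (2 * b
  * y)) (exp (2 * b * z))\<close>. The first two factors are absorbed into the weights
  \<open>c\<close>.\<close>

lemma exp_kernel_nonneg:
  fixes x c :: "'a \<Rightarrow> real"
  assumes "finite A" "0 \<le> b"
  shows "0 \<le> (\<Sum>i\<in>A. \<Sum>j\<in>A. c i * c j * exp (- b * \<bar>x i - x j\<bar>))"
proof -
  have "exp (- b * \<bar>y - z\<bar>) = exp (- b * y) * exp (- b * z) * min (exp (2 * b * y)) (exp (2 * b * z))"
    for y z :: real
  proof (cases "y \<le> z")
    case True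
    then have "b * y \<le> b * z" using assms(2) by (rule mult_left_mono)
    with True show ?thesis
      by (auto simp: min_def algebra_simps simp flip: exp_add)
  next
    case False
    then have "b * z \<le> b * y" using assms(2) by (intro mult_left_mono) auto
    with False show ?thesis
      by (auto simp: min_def algebra_simps simp flip: exp_add)
  qed
  then have "(\<Sum>i\<in>A. \<Sum>j\<in>A. c i * c j * exp (- b * \<bar>x i - x j\<bar>))
     = (\<Sum>i\<in>A. \<Sum>j\<in>A. (c i * exp (- b * x i)) * (c j * exp (- b * x j))
         * min (exp (2 * b * x i)) (exp (2 * b * x j)))"
    by (simp only: mult_ac)
  then show ?thesis
    using min_kernel_nonneg[OF assms(1), of "\<lambda>i. exp (2 * b * x i)" "\<lambda>i. c i * exp (- b * x i)"]
    by simp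
qed

text \<open>The addition formula for \<open>cos (a * x i - a * x j)\<close> splits the form into two
  exponential-kernel forms, with weights multiplied by cosines and by sines.\<close>

lemma exp_cos_kernel_nonneg:
  fixes x c :: "'a \<Rightarrow> real"
  assumes "finite A" "0 \<le> b"
  shows "0 \<le> (\<Sum>i\<in>A. \<Sum>j\<in>A. c i * c j * (exp (- b * \<bar>x i - x j\<bar>) * cos (a * (x i - x j))))"
proof -
  have "(\<Sum>i\<in>A. \<Sum>j\<in>A. c i * c j * (exp (- b * \<bar>x i - x j\<bar>) * cos (a * (x i - x j))))
     = (\<Sum>i\<in>A. \<Sum>j\<in>A. (c i * cos (a * x i)) * (c j * cos (a * x j)) * exp (- b * \<bar>x i - x j\<bar>))
     + (\<Sum>i\<in>A. \<Sum>j\<in>A. (c i * sin (a * x i)) * (c j * sin (a * x j)) * exp (- b * \<bar>x i - x j\<bar>))"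
    unfolding sum.distrib[symmetric]
    by (intro sum.cong refl) (simp add: right_diff_distrib cos_diff algebra_simps)
  then show ?thesis
    using exp_kernel_nonneg[OF assms, of "\<lambda>i. c i * cos (a * x i)" x]
      exp_kernel_nonneg[OF assms, of "\<lambda>i. c i * sin (a * x i)" x] by linarith
qed

text \<open>\<open>Im (cnj (u i) * u j)\<close> is antisymmetric in \<open>i\<close> and
  \<open>j\<close>, so its products with the symmetric \<open>Im (K i j)\<close> cancel in the
  double sum. The kernel is symmetric rather than Hermitian, and only its real part
  survives.\<close>

lemma Re_sum_symmetric_kernel:
  fixes u :: "'a \<Rightarrow> complex" and K :: "'a \<Rightarrow> 'a \<Rightarrow> complex"
  assumes "\<And>i j. K i j = K j i"
  shows "Re (\<Sum>i\<in>A. \<Sum>j\<in>A. cnj (u i) * u j * K i j)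
    = (\<Sum>i\<in>A. \<Sum>j\<in>A. Re (u i) * Re (u j) * Re (K i j))
    + (\<Sum>i\<in>A. \<Sum>j\<in>A. Im (u i) * Im (u j) * Re (K i j))"
proof -
  have "(\<Sum>i\<in>A. \<Sum>j\<in>A. Re (u i) * Im (u j) * Im (K i j))
      = (\<Sum>i\<in>A. \<Sum>j\<in>A. Im (u i) * Re (u j) * Im (K i j))"
    by (subst sum.swap) (simp add: assms mult_ac)
  then show ?thesis
    by (simp add: sum.distrib sum_subtractf algebra_simps)
qed

lemma Re_exp_kernel_nonneg:
  fixes x :: "'a \<Rightarrow> real" and u :: "'a \<Rightarrow> complex"
  assumes "finite A" "0 \<le> Im E"
  shows "0 \<le> Re (\<Sum>i\<in>A. \<Sum>j\<in>A. cnj (u i) * u j * exp (\<i> * E * of_real \<bar>x i - x j\<bar>))"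
proof -
  \<comment> \<open>Evenness of the cosine replaces the distance by the signed difference, the form
    that the addition formula handles.\<close>
  have "cos (Re E * \<bar>y\<bar>) = cos (Re E * y)" for y
    by (cases "0 \<le> y") auto
  then have "Re (exp (\<i> * E * of_real \<bar>y\<bar>)) = exp (- Im E * \<bar>y\<bar>) * cos (Re E * y)" for y
    by (simp add: Re_exp)
  then show ?thesis
    using exp_cos_kernel_nonneg[OF assms, of "\<lambda>i. Re (u i)" x "Re E"]
      exp_cos_kernel_nonneg[OF assms, of "\<lambda>i. Im (u i)" x "Re E"]
    by (subst Re_sum_symmetric_kernel) (simp_all add: abs_minus_commute)
qed

section \<open>Linear systems with entire coefficients\<close>

lemma holomorphic_on_det:
  fixes A :: "complex \<Rightarrow> complex^'n^'n"
  assumes "\<And>i j. (\<lambda>z. A z $ i $ j) holomorphic_on S"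
  shows "(\<lambda>z. det (A z)) holomorphic_on S"
  unfolding det_def by (intro holomorphic_intros assms)

text \<open>Cramer's rule writes the solution as a quotient of entire functions. \<open>x\<close> is
  constrained only where the determinant is nonzero; the nonempty set \<open>U\<close> ensures that
  the exceptional points are isolated, so they do not affect meromorphy.\<close>

lemma linear_system_solution_meromorphic:
  fixes A :: "complex \<Rightarrow> complex^'n^'n" and b x :: "complex \<Rightarrow> complex^'n"
  assumes A: "\<And>i j. (\<lambda>z. A z $ i $ j) holomorphic_on UNIV"
    and b: "\<And>i. (\<lambda>z. b z $ i) holomorphic_on UNIV"
    and solution: "\<And>z. det (A z) \<noteq> 0 \<Longrightarrow> A z *v x z = b z"
    and U: "U \<noteq> {}" "\<And>z. z \<in> U \<Longrightarrow> det (A z) \<noteq> 0"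
  shows "(\<lambda>z. x z $ k) meromorphic_on UNIV" and "(\<lambda>z. x z $ k) holomorphic_on U"
proof -
  define num where "num z = det (\<chi> i j. if j = k then b z $ i else A z $ i $ j)" for z
  have num: "num holomorphic_on UNIV"
    unfolding num_def
  proof (rule holomorphic_on_det)
    show "(\<lambda>z. (\<chi> i j. if j = k then b z $ i else A z $ i $ j) $ i $ j) holomorphic_on UNIV" for i j
      using A b by (cases "j = k") simp_all
  qed
  have den: "(\<lambda>z. det (A z)) holomorphic_on UNIV"
    by (rule holomorphic_on_det) (rule A)
  have eq: "x z $ k = num z / det (A z)" if "det (A z) \<noteq> 0" for z
    using solution[OF that] cramer[OF that, of "x z" "b z"] by (simp add: num_def)
  obtain z0 where "det (A z0) \<noteq> 0" using U by blast
  \<comment> \<open>An entire function that is nonzero at \<open>z0\<close> has only isolated zeros,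
    so every \<open>z\<close>, even a zero of the determinant, has a punctured neighbourhood on
    which the quotient formula holds.\<close>
  then have "\<forall>\<^sub>F w in at z. det (A w) \<noteq> 0 \<and> w \<in> UNIV" for z
    by (intro non_zero_neighbour_alt[OF den, of z z0]) auto
  then have "\<forall>\<^sub>F w in at z. x w $ k = num w / det (A w)" for z
    by (rule eventually_mono) (simp add: eq)
  moreover have "(\<lambda>z. num z / det (A z)) meromorphic_on UNIV"
    using num den
    by (intro meromorphic_on_divide analytic_on_imp_meromorphic_on) (simp_all add: analytic_on_open)
  ultimately show "(\<lambda>z. x z $ k) meromorphic_on UNIV"
    using meromorphic_on_cong[of UNIV "\<lambda>z. x z $ k" "\<lambda>z. num z / det (A z)"] by blast
  have "(\<lambda>z. num z / det (A z)) holomorphic_on U"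
    using U(2) by (intro holomorphic_intros holomorphic_on_subset[OF num] holomorphic_on_subset[OF den]) auto
  then show "(\<lambda>z. x z $ k) holomorphic_on U"
    by (rule holomorphic_transform) (simp add: eq U(2))
qed

section \<open>Emitter amplitudes\<close>

text \<open>The matrix \<open>A(E)\<close> left after the fields are eliminated. Its diagonal
  includes the self-interaction \<open>\<i>\<close> times the sum of the squared couplings: the
  right- and left-moving fields each contribute one half at the emitter's own position.\<close>

definition emitter_matrix ::
  "('q::finite, 'w::finite) waveguide_system \<Rightarrow> complex \<Rightarrow> complex^'q^'q" where
  "emitter_matrix S E = (\<chi> Q P. (if Q = P then E - of_real (frequency S Q) else 0)
     + \<i> * (\<Sum>w\<in>UNIV. of_real (coupling S Q w) * of_real (coupling S P w)
            * exp (\<i> * E * of_real \<bar>position S Q w - position S P w\<bar>)))"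

lemma emitter_matrix_mult_nth:
  "(emitter_matrix S E *v e) $ Q = (E - of_real (frequency S Q)) * e $ Q
     + \<i> * (\<Sum>P\<in>UNIV. \<Sum>w\<in>UNIV. of_real (coupling S Q w) * of_real (coupling S P w)
            * exp (\<i> * E * of_real \<bar>position S Q w - position S P w\<bar>) * e $ P)"
  by (simp add: emitter_matrix_def matrix_vector_mult_def distrib_right sum.distrib
        if_distrib[of "\<lambda>z. z * _"] sum_distrib_left sum_distrib_right mult.assoc cong: if_cong)

definition incident_vector ::
  "('q::finite, 'w::finite) waveguide_system \<Rightarrow> direction \<Rightarrow> 'w \<Rightarrow> complex \<Rightarrow> complex^'q" where
  "incident_vector S d w0 E = (\<chi> Q. of_real (coupling S Q w0)
     * exp ((if d = Rightward then \<i> else - \<i>) * E * of_real (position S Q w0)))"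

text \<open>An emitter radiates rightward to its right and leftward to its left, so the two step
  functions glue the exponentials into one function of the distance. The value
  \<open>heaviside 0 = 1/2\<close> makes this hold at distance zero as well.\<close>

lemma right_field_plus_left_field:
  "right_field S d w0 E e w x + left_field S d w0 E e w x
   = (if w = w0 then exp ((if d = Rightward then \<i> else - \<i>) * E * of_real x) else 0)
     - \<i> * (\<Sum>P\<in>UNIV. of_real (coupling S P w) * e P * exp (\<i> * E * of_real \<bar>x - position S P w\<bar>))"
proof -
  have "exp (\<i> * E * of_real y) * of_real (heaviside y) + exp (- \<i> * E * of_real y) * of_real (heaviside (- y))
      = exp (\<i> * E * of_real \<bar>y\<bar>)" for y
    by (auto simp: heaviside_def)
  from this[of "x - position S P w" for P]
  have "(\<Sum>P\<in>UNIV. of_real (coupling S P w) * e P * exp (\<i> * E * of_real \<bar>x - position S P w\<bar>))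
    = (\<Sum>P\<in>UNIV. of_real (coupling S P w) * e P * exp (\<i> * E * of_real (x - position S P w))
              * of_real (heaviside (x - position S P w)))
    + (\<Sum>P\<in>UNIV. of_real (coupling S P w) * e P * exp (- \<i> * E * of_real (x - position S P w))
              * of_real (heaviside (position S P w - x)))"
    unfolding sum.distrib[symmetric]
    by (intro sum.cong refl) (metis (no_types, lifting) distrib_left minus_diff_eq mult.assoc)
  then show ?thesis
    unfolding right_field_def left_field_def
    by (cases d) (simp_all add: algebra_simps)
qed

lemma emitter_equations_iff:
  "emitter_equations S d w0 E e \<longleftrightarrow> emitter_matrix S E *v vec_lambda e = incident_vector S d w0 E"
proof -
  have "(E - of_real (frequency S Q)) * e Q =
        (\<Sum>w\<in>UNIV. of_real (coupling S Q w) *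
           (right_field S d w0 E e w (position S Q w) + left_field S d w0 E e w (position S Q w)))
     \<longleftrightarrow> (emitter_matrix S E *v vec_lambda e) $ Q = incident_vector S d w0 E $ Q" for Q
  proof -
    let ?K = "\<lambda>P w. exp (\<i> * E * of_real \<bar>position S Q w - position S P w\<bar>)"
    have "(\<Sum>w\<in>UNIV. of_real (coupling S Q w) *
           (right_field S d w0 E e w (position S Q w) + left_field S d w0 E e w (position S Q w)))
      = incident_vector S d w0 E $ Q
        - (\<Sum>w\<in>UNIV. \<Sum>P\<in>UNIV. \<i> * (of_real (coupling S Q w) * of_real (coupling S P w) * ?K P w) * e P)"
      unfolding right_field_plus_left_field incident_vector_def
      by (simp add: right_diff_distrib sum_subtractf sum_distrib_left if_distrib[of "\<lambda>z. _ * z"]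
            sum.delta' mult_ac cong: if_cong)
    also have "(\<Sum>w\<in>UNIV. \<Sum>P\<in>UNIV. \<i> * (of_real (coupling S Q w) * of_real (coupling S P w) * ?K P w) * e P)
      = \<i> * (\<Sum>P\<in>UNIV. \<Sum>w\<in>UNIV. of_real (coupling S Q w) * of_real (coupling S P w) * ?K P w * e P)"
      by (subst sum.swap) (simp add: sum_distrib_left mult.assoc)
    finally have rhs: "(\<Sum>w\<in>UNIV. of_real (coupling S Q w) *
           (right_field S d w0 E e w (position S Q w) + left_field S d w0 E e w (position S Q w)))
      = incident_vector S d w0 E $ Q
        - \<i> * (\<Sum>P\<in>UNIV. \<Sum>w\<in>UNIV. of_real (coupling S Q w) * of_real (coupling S P w) * ?K P w * e P)" .
    show ?thesis
      unfolding rhs by (simp add: emitter_matrix_mult_nth eq_diff_eq)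
  qed
  then show ?thesis
    by (simp add: emitter_equations_def vec_eq_iff)
qed

text \<open>Regrouping by waveguide, with weights \<open>coupling S Q w * e $ Q\<close>, turns the
  interaction into one exponential-kernel form per waveguide.\<close>

lemma emitter_matrix_quadratic_form:
  "(\<Sum>Q\<in>UNIV. cnj (e $ Q) * (emitter_matrix S E *v e) $ Q)
   = (\<Sum>Q\<in>UNIV. (E - of_real (frequency S Q)) * of_real ((cmod (e $ Q))\<^sup>2))
     + \<i> * (\<Sum>w\<in>UNIV. \<Sum>Q\<in>UNIV. \<Sum>P\<in>UNIV.
          cnj (of_real (coupling S Q w) * e $ Q) * (of_real (coupling S P w) * e $ P)
          * exp (\<i> * E * of_real \<bar>position S Q w - position S P w\<bar>))"
proof -
  let ?F = "\<lambda>Q P w. cnj (of_real (coupling S Q w) * e $ Q) * (of_real (coupling S P w) * e $ P)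
          * exp (\<i> * E * of_real \<bar>position S Q w - position S P w\<bar>)"
  have "cnj (e $ Q) * (emitter_matrix S E *v e) $ Q
      = (E - of_real (frequency S Q)) * of_real ((cmod (e $ Q))\<^sup>2)
        + \<i> * (\<Sum>P\<in>UNIV. \<Sum>w\<in>UNIV. ?F Q P w)" for Q
    by (simp add: emitter_matrix_mult_nth distrib_left sum_distrib_left complex_norm_square mult_ac
          del: of_real_power)
  moreover have "(\<Sum>Q\<in>UNIV. \<Sum>P\<in>UNIV. \<Sum>w\<in>UNIV. ?F Q P w) = (\<Sum>w\<in>UNIV. \<Sum>Q\<in>UNIV. \<Sum>P\<in>UNIV. ?F Q P w)"
    by (subst sum.swap[of _ UNIV "UNIV :: 'w set"]) (intro sum.cong refl sum.swap)
  ultimately show ?thesis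
    by (simp add: sum.distrib flip: sum_distrib_left)
qed

text \<open>For a null vector \<open>e\<close> the imaginary part of the quadratic form is zero, yet
  it is \<open>Im E\<close> times the squared norm of \<open>e\<close> plus nonnegative kernel
  terms. Hence the null space is trivial.\<close>

lemma det_emitter_matrix_nonzero:
  assumes "Im E > 0"
  shows "det (emitter_matrix S E) \<noteq> 0"
proof -
  have "e = 0" if e: "emitter_matrix S E *v e = 0" for e
  proof -
    let ?k = "\<lambda>w. \<Sum>Q\<in>UNIV. \<Sum>P\<in>UNIV.
          cnj (of_real (coupling S Q w) * e $ Q) * (of_real (coupling S P w) * e $ P)
          * exp (\<i> * E * of_real \<bar>position S Q w - position S P w\<bar>)"
    have "0 \<le> (\<Sum>w\<in>UNIV. Re (?k w))"
      using assms by (intro sum_nonneg Re_exp_kernel_nonneg) auto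
    moreover have "0 = Im (\<Sum>Q\<in>UNIV. cnj (e $ Q) * (emitter_matrix S E *v e) $ Q)"
      by (simp add: e)
    \<comment> \<open>The real frequencies drop out of the imaginary part, and
      \<open>Im (\<i> * z) = Re z\<close> turns the kernel terms into real parts.\<close>
    then have "0 = (\<Sum>Q\<in>UNIV. Im E * (cmod (e $ Q))\<^sup>2) + (\<Sum>w\<in>UNIV. Re (?k w))"
      unfolding emitter_matrix_quadratic_form by (simp del: of_real_power)
    moreover have "0 \<le> Im E * (cmod (e $ Q))\<^sup>2" for Q
      using assms by simp
    ultimately have "(\<Sum>Q\<in>UNIV. Im E * (cmod (e $ Q))\<^sup>2) = 0"
      by (smt (verit) sum_nonneg)
    then have "\<forall>Q. Im E * (cmod (e $ Q))\<^sup>2 = 0"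
      using assms by (subst (asm) sum_nonneg_eq_0_iff) auto
    then show "e = 0"
      using assms by (simp add: vec_eq_iff)
  qed
  then show ?thesis
    by (simp add: invertible_det_nz[symmetric] invertible_left_inverse matrix_left_invertible_ker)
qed

text \<open>A nonzero determinant gives existence and uniqueness, which is what the definite
  description in \<open>emitter_amplitudes\<close> requires.\<close>

lemma emitter_amplitudes_solve:
  assumes "det (emitter_matrix S E) \<noteq> 0"
  shows "emitter_matrix S E *v vec_lambda (emitter_amplitudes S d w0 E) = incident_vector S d w0 E"
proof -
  obtain v where v: "emitter_matrix S E *v y = incident_vector S d w0 E \<longleftrightarrow> y = v" for y
    using cramer[OF assms] by blast
  have "\<exists>!e. emitter_equations S d w0 E e"
  proof
    show "emitter_equations S d w0 E (vec_nth v)"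
      unfolding emitter_equations_iff v by (simp add: vec_nth_inverse)
    show "e = vec_nth v" if "emitter_equations S d w0 E e" for e
      using that unfolding emitter_equations_iff v by (auto simp: fun_eq_iff)
  qed
  then show ?thesis
    unfolding emitter_amplitudes_def emitter_equations_iff[symmetric] by (rule theI')
qed

text \<open>The upper half-plane serves as \<open>U\<close>: the determinant has no zero there,
  which yields holomorphy on it and also shows that the determinant is not identically zero.\<close>

lemma
  shows emitter_amplitudes_meromorphic: "(\<lambda>E. emitter_amplitudes S d w0 E Q) meromorphic_on UNIV"
    and emitter_amplitudes_holomorphic: "(\<lambda>E. emitter_amplitudes S d w0 E Q) holomorphic_on {E. Im E > 0}"
proof -
  have A: "(\<lambda>E. emitter_matrix S E $ i $ j) holomorphic_on UNIV" for i j
    unfolding emitter_matrix_def by (cases "i = j") (auto intro!: holomorphic_intros)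
  have b: "(\<lambda>E. incident_vector S d w0 E $ i) holomorphic_on UNIV" for i
    unfolding incident_vector_def by (auto intro!: holomorphic_intros)
  have "\<i> \<in> {E. Im E > 0}" by simp
  then have ne: "{E. Im E > 0} \<noteq> {}" by blast
  note * = linear_system_solution_meromorphic[OF A b, where U = "{E. Im E > 0}" and k = Q
      and x = "\<lambda>E. vec_lambda (emitter_amplitudes S d w0 E)"]
  show "(\<lambda>E. emitter_amplitudes S d w0 E Q) meromorphic_on UNIV"
    using *(1)[OF emitter_amplitudes_solve ne det_emitter_matrix_nonzero] by simp
  show "(\<lambda>E. emitter_amplitudes S d w0 E Q) holomorphic_on {E. Im E > 0}"
    using *(2)[OF emitter_amplitudes_solve ne det_emitter_matrix_nonzero] by simp
qed

section \<open>Field coefficients\<close>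

text \<open>A component is connected and avoids the coupling points, so it lies entirely on one side
  of each emitter that couples to \<open>w\<close>.\<close>

lemma heaviside_constant_off_coupling_points:
  assumes I: "I \<in> components (- coupling_points S w)" and x: "x \<in> I" "y \<in> I"
    and V: "coupling S Q w \<noteq> 0"
  shows "heaviside (x - position S Q w) = heaviside (y - position S Q w)"
    and "heaviside (position S Q w - x) = heaviside (position S Q w - y)"
proof -
  have "position S Q w \<notin> I"
    using in_components_subset[OF I] V by (auto simp: coupling_points_def)
  then have "x < position S Q w \<longleftrightarrow> y < position S Q w" "x \<noteq> position S Q w" "y \<noteq> position S Q w"
    using connectedD_interval[OF in_components_connected[OF I]] x by (smt (verit))+
  then show "heaviside (x - position S Q w) = heaviside (y - position S Q w)"
    and "heaviside (position S Q w - x) = heaviside (position S Q w - y)"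
    by (auto simp: heaviside_def)
qed

lemma the_coefficient_eq:
  fixes g :: "'a \<Rightarrow> complex"
  assumes "x0 \<in> I" "\<And>x. x \<in> I \<Longrightarrow> F x = c * g x" "g x0 \<noteq> 0"
  shows "(THE c. \<forall>x\<in>I. F x = c * g x) = c"
  using assms by (intro the_equality) auto

text \<open>Factoring \<open>exp (\<i> * E * of_real x)\<close> out of the field leaves step
  functions that are constant on \<open>I\<close>, hence may be evaluated at a sample point
  \<open>x0\<close>. The exponential never vanishes, so the coefficient is unique.\<close>

lemma right_coefficient_eq:
  assumes "I \<in> components (- coupling_points S w)" "x0 \<in> I"
  shows "right_coefficient S d w0 w I E = (if d = Rightward \<and> w = w0 then 1 else 0)
     - \<i> * (\<Sum>Q\<in>UNIV. of_real (coupling S Q w) * emitter_amplitudes S d w0 E Q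
          * exp (- \<i> * E * of_real (position S Q w)) * of_real (heaviside (x0 - position S Q w)))"
  unfolding right_coefficient_def
proof (rule the_coefficient_eq[where ?x0.0 = x0])
  fix x assume "x \<in> I"
  then have *: "of_real (coupling S Q w) * emitter_amplitudes S d w0 E Q
       * exp (\<i> * E * of_real (x - position S Q w)) * of_real (heaviside (x - position S Q w))
     = (of_real (coupling S Q w) * emitter_amplitudes S d w0 E Q
       * exp (- \<i> * E * of_real (position S Q w)) * of_real (heaviside (x0 - position S Q w)))
       * exp (\<i> * E * of_real x)" for Q
    using heaviside_constant_off_coupling_points(1)[OF assms(1) \<open>x \<in> I\<close> assms(2), of Q]
    \<comment> \<open>An emitter decoupled from \<open>w\<close> may sit inside \<open>I\<close>,
      where its step function jumps, but then its term is zero.\<close>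
    by (cases "coupling S Q w = 0") (simp_all add: algebra_simps exp_diff exp_minus field_simps)
  then show "right_field S d w0 E (emitter_amplitudes S d w0 E) w x =
      ((if d = Rightward \<and> w = w0 then 1 else 0)
     - \<i> * (\<Sum>Q\<in>UNIV. of_real (coupling S Q w) * emitter_amplitudes S d w0 E Q
          * exp (- \<i> * E * of_real (position S Q w)) * of_real (heaviside (x0 - position S Q w))))
      * exp (\<i> * E * of_real x)"
    unfolding right_field_def * sum_distrib_right[symmetric] by (simp add: left_diff_distrib mult.assoc)
qed (use assms in auto)

lemma left_coefficient_eq:
  assumes "I \<in> components (- coupling_points S w)" "x0 \<in> I"
  shows "left_coefficient S d w0 w I E = (if d = Leftward \<and> w = w0 then 1 else 0)
     - \<i> * (\<Sum>Q\<in>UNIV. of_real (coupling S Q w) * emitter_amplitudes S d w0 E Q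
          * exp (\<i> * E * of_real (position S Q w)) * of_real (heaviside (position S Q w - x0)))"
  unfolding left_coefficient_def
proof (rule the_coefficient_eq[where ?x0.0 = x0])
  fix x assume "x \<in> I"
  then have *: "of_real (coupling S Q w) * emitter_amplitudes S d w0 E Q
       * exp (- \<i> * E * of_real (x - position S Q w)) * of_real (heaviside (position S Q w - x))
     = (of_real (coupling S Q w) * emitter_amplitudes S d w0 E Q
       * exp (\<i> * E * of_real (position S Q w)) * of_real (heaviside (position S Q w - x0)))
       * exp (- \<i> * E * of_real x)" for Q
    using heaviside_constant_off_coupling_points(2)[OF assms(1) \<open>x \<in> I\<close> assms(2), of Q]
    by (cases "coupling S Q w = 0") (simp_all add: algebra_simps exp_diff exp_minus field_simps)
  then show "left_field S d w0 E (emitter_amplitudes S d w0 E) w x =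
      ((if d = Leftward \<and> w = w0 then 1 else 0)
     - \<i> * (\<Sum>Q\<in>UNIV. of_real (coupling S Q w) * emitter_amplitudes S d w0 E Q
          * exp (\<i> * E * of_real (position S Q w)) * of_real (heaviside (position S Q w - x0))))
      * exp (- \<i> * E * of_real x)"
    unfolding left_field_def * sum_distrib_right[symmetric] by (simp add: left_diff_distrib mult.assoc)
qed (use assms in auto)

lemma scattering_parameter_meromorphic_holomorphic:
  assumes "f \<in> scattering_parameters S"
  shows "f meromorphic_on UNIV \<and> f holomorphic_on {E. Im E > 0}"
proof -
  have exp_meromorphic: "(\<lambda>E. exp (c * E * y)) meromorphic_on UNIV" for c y :: complex
    by (intro analytic_on_imp_meromorphic_on analytic_intros)
  from assms show ?thesis
  proof cases
    case (emitter d w0 Q)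
    then show ?thesis
      by (simp add: emitter_amplitudes_meromorphic emitter_amplitudes_holomorphic)
  next
    case (right I w d w0)
    \<comment> \<open>The sample point is independent of \<open>E\<close>, and the coefficient
      formula holds for every \<open>E\<close>, so it is an identity of functions even where the
      determinant vanishes.\<close>
    then obtain x0 where "x0 \<in> I" using in_components_nonempty by blast
    with right have f: "f = (\<lambda>E. (if d = Rightward \<and> w = w0 then 1 else 0)
     - \<i> * (\<Sum>Q\<in>UNIV. of_real (coupling S Q w) * emitter_amplitudes S d w0 E Q
          * exp (- \<i> * E * of_real (position S Q w)) * of_real (heaviside (x0 - position S Q w))))"
      by (auto simp: right_coefficient_eq)
    show ?thesis
      unfolding f
      by (intro conjI meromorphic_intros holomorphic_intros exp_meromorphic
          emitter_amplitudes_meromorphic emitter_amplitudes_holomorphic)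
  next
    case (left I w d w0)
    then obtain x0 where "x0 \<in> I" using in_components_nonempty by blast
    with left have f: "f = (\<lambda>E. (if d = Leftward \<and> w = w0 then 1 else 0)
     - \<i> * (\<Sum>Q\<in>UNIV. of_real (coupling S Q w) * emitter_amplitudes S d w0 E Q
          * exp (\<i> * E * of_real (position S Q w)) * of_real (heaviside (position S Q w - x0))))"
      by (auto simp: left_coefficient_eq)
    show ?thesis
      unfolding f
      by (intro conjI meromorphic_intros holomorphic_intros exp_meromorphic
          emitter_amplitudes_meromorphic emitter_amplitudes_holomorphic)
  qed
qed

theorem theorem1:
  fixes S :: "('q::finite, 'w::finite) waveguide_system"
    and f :: "complex \<Rightarrow> complex"
  assumes "\<And>Q. frequency S Q > 0"
    and "\<And>Q w. coupling S Q w \<ge> 0"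
    and "f \<in> scattering_parameters S"
  shows "f meromorphic_on UNIV \<and> (\<forall>E. Im E > 0 \<longrightarrow> \<not> is_pole f E) \<and>
    (\<forall>\<Omega>::real. (\<lambda>\<Delta>. f (\<Delta> + of_real \<Omega>)) meromorphic_on UNIV \<and>
       (\<forall>\<Delta>. Im \<Delta> > 0 \<longrightarrow> \<not> is_pole (\<lambda>\<Delta>. f (\<Delta> + of_real \<Omega>)) \<Delta>))"
proof -
  have mero: "f meromorphic_on UNIV" and holo: "f holomorphic_on {E. Im E > 0}"
    using scattering_parameter_meromorphic_holomorphic[OF assms(3)] by auto
  have no_pole: "\<not> is_pole f E" if "Im E > 0" for E
    using that holo by (intro not_is_pole_holomorphic[of "{E. Im E > 0}"]) (auto simp: open_halfspace_Im_gt)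
  have "(\<lambda>\<Delta>. f (\<Delta> + of_real \<Omega>)) meromorphic_on UNIV" for \<Omega>
    using mero by (rule meromorphic_on_compose) (auto intro!: analytic_intros)
  \<comment> \<open>A shift by a real \<Omega> preserves the imaginary part, so the detuning and the
    energy lie in the upper half-plane together.\<close>
  moreover have "\<not> is_pole (\<lambda>\<Delta>. f (\<Delta> + of_real \<Omega>)) \<Delta>" if "Im \<Delta> > 0" for \<Omega> :: real and \<Delta>
    using no_pole[of "\<Delta> + of_real \<Omega>"] is_pole_shift_iff[of f "of_real \<Omega>" \<Delta>] that
    by (simp add: o_def add.commute)
  ultimately show ?thesis
    using mero no_pole by blast
qed

end
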